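(* On the part of $J^3$ where $\det(\mathrm{Hess}(u))=u_{xx}u_{yy}-u_{xy}^2<0$ and $u_{yy}\neq0$, let $\mathcal{E}^1_-$ be the third-order PDE $$\begin{aligned}&\sqrt{-\det(\mathrm{Hess}(u))}\,\big(u_{xx}u_{yy}u_{yyy}-3u_{xxy}u_{yy}^2-4u_{xy}^2u_{yyy}+6u_{xy}u_{xyy}u_{yy}\big)\\&+\big(-3u_{xx}u_{xy}u_{yy}u_{yyy}+3u_{xx}u_{xyy}u_{yy}^2-u_{xxx}u_{yy}^3+3u_{xxy}u_{xy}u_{yy}^2+4u_{xy}^3u_{yyy}-6u_{xy}^2u_{xyy}u_{yy}\big)=0\end{aligned}$$ and let $\mathcal{V}$ be the $3$-dimensional distribution on $J^2_-$ $$\mathcal{V}=\big\langle -u_{yy}D^{(2)}_x+bD^{(2)}_y\,,\;2b\,\partial_{u_{xx}}+u_{yy}\,\partial_{u_{xy}}\,,\;-b^2\,\partial_{u_{xx}}+u_{yy}^2\,\partial_{u_{yy}}\big\rangle,\qquad b=u_{xy}-\sqrt{-\det(\mathrm{Hess}(u))}.$$ Then $\mathcal{E}^1_-=\mathcal{E}_{\mathcal{V}}$, where $$\mathcal{E}_{\mathcal{V}}=\{a^3\in J^3_-\mid \mathcal{T}^3_{a^3}\cap\mathcal{V}_{a^2}\neq0,\ a^2=\pi_{3,2}(a^3)\}.$$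
   Context: $J^\ell$ denotes the space of $\ell$-jets of functions $u(x,y)$, with coordinates $x,y,u,u_x,u_y,u_{xx},u_{xy},u_{yy},u_{xxx},\dots$; $J^\ell_-$ ($\ell\ge2$) is the subset where $u_{xx}u_{yy}-u_{xy}^2<0$, and $\pi_{3,2}:J^3\to J^2$ is the natural projection. On $J^2$ put $D^{(2)}_x=\partial_x+u_x\partial_u+u_{xx}\partial_{u_x}+u_{xy}\partial_{u_y}$ and $D^{(2)}_y=\partial_y+u_y\partial_u+u_{xy}\partial_{u_x}+u_{yy}\partial_{u_y}$. For $a^3\in J^3$ over $a^2\in J^2$, $\mathcal{T}^3_{a^3}\subset T_{a^2}J^2$ is the tangent plane at $a^2$ of the second jet extension of any surface $u=f(x,y)$ whose $3$-jet is $a^3$; it is spanned by $D^{(2)}_x+u_{xxx}\partial_{u_{xx}}+u_{xxy}\partial_{u_{xy}}+u_{xyy}\partial_{u_{yy}}$ and $D^{(2)}_y+u_{xxy}\partial_{u_{xx}}+u_{xyy}\partial_{u_{xy}}+u_{yyy}\partial_{u_{yy}}$. *)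

theory Defs
  imports "HOL-Analysis.Analysis"
begin

section \<open>Jet spaces of functions of two variables\<close>

text \<open>
  Jets are given by their coordinates, in the order
  \<open>(x, y, u, u_x, u_y, u_xx, u_xy, u_yy)\<close> on \<open>J^2\<close>; the four additional coordinates on \<open>J^3\<close> are
  \<open>(u_xxx, u_xxy, u_xyy, u_yyy)\<close>. Thus \<open>J^2\<close> is the vector space \<open>real^8\<close> (as an iterated product)
  and is identified with each of its tangent spaces.
\<close>

type_synonym jet2 = "real \<times> real \<times> real \<times> real \<times> real \<times> real \<times> real \<times> real"
type_synonym jet3 = "jet2 \<times> real \<times> real \<times> real \<times> real"

definition proj32 :: "jet3 \<Rightarrow> jet2" where
  "proj32 a = fst a"

fun u_yy :: "jet2 \<Rightarrow> real" where
  "u_yy (x, y, u, ux, uy, uxx, uxy, uyy) = uyy"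

fun det_Hess :: "jet2 \<Rightarrow> real" where
  "det_Hess (x, y, u, ux, uy, uxx, uxy, uyy) = uxx * uyy - uxy\<^sup>2"

definition J2_minus :: "jet2 set" where
  "J2_minus = {a. det_Hess a < 0}"

definition J3_minus :: "jet3 set" where
  "J3_minus = {a. proj32 a \<in> J2_minus}"

subsection \<open>Jet extensions of smooth functions\<close>

definition pd_x :: "(real \<times> real \<Rightarrow> real) \<Rightarrow> real \<times> real \<Rightarrow> real" where
  "pd_x f p = frechet_derivative f (at p) (1, 0)"

definition pd_y :: "(real \<times> real \<Rightarrow> real) \<Rightarrow> real \<times> real \<Rightarrow> real" where
  "pd_y f p = frechet_derivative f (at p) (0, 1)"

fun C_k :: "nat \<Rightarrow> (real \<times> real \<Rightarrow> real) \<Rightarrow> bool" where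
  "C_k 0 f \<longleftrightarrow> continuous_on UNIV f"
| "C_k (Suc k) f \<longleftrightarrow> (\<forall>p. f differentiable (at p)) \<and> C_k k (pd_x f) \<and> C_k k (pd_y f)"

definition smooth2 :: "(real \<times> real \<Rightarrow> real) \<Rightarrow> bool" where
  "smooth2 f \<longleftrightarrow> (\<forall>k. C_k k f)"

definition j2 :: "(real \<times> real \<Rightarrow> real) \<Rightarrow> real \<times> real \<Rightarrow> jet2" where
  "j2 f p = (fst p, snd p, f p, pd_x f p, pd_y f p,
             pd_x (pd_x f) p, pd_y (pd_x f) p, pd_y (pd_y f) p)"

definition j3 :: "(real \<times> real \<Rightarrow> real) \<Rightarrow> real \<times> real \<Rightarrow> jet3" where
  "j3 f p = (j2 f p, pd_x (pd_x (pd_x f)) p, pd_y (pd_x (pd_x f)) p,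
             pd_y (pd_y (pd_x f)) p, pd_y (pd_y (pd_y f)) p)"

text \<open>
  The tangent plane at \<open>a^2\<close> of the image of \<open>j2 f\<close>, for any \<open>f\<close> with 3-jet \<open>a^3\<close>. That it does not
  depend on the choice of \<open>f\<close>, and that such an \<open>f\<close> exists, is shown in \<open>range_derivative_j2\<close>
  and \<open>ex_smooth2_j3\<close> below. Jets of globally defined functions suffice, since
  the plane only depends on the 3-jet.
\<close>

definition T3 :: "jet3 \<Rightarrow> jet2 set" where
  "T3 a = \<Union> {range (frechet_derivative (j2 f) (at p)) | f p. smooth2 f \<and> j3 f p = a}"

subsection \<open>Vector fields on the space of 2-jets\<close>

definition del_x :: jet2 where "del_x = (1, 0, 0, 0, 0, 0, 0, 0)"
definition del_y :: jet2 where "del_y = (0, 1, 0, 0, 0, 0, 0, 0)"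
definition del_u :: jet2 where "del_u = (0, 0, 1, 0, 0, 0, 0, 0)"
definition del_ux :: jet2 where "del_ux = (0, 0, 0, 1, 0, 0, 0, 0)"
definition del_uy :: jet2 where "del_uy = (0, 0, 0, 0, 1, 0, 0, 0)"
definition del_uxx :: jet2 where "del_uxx = (0, 0, 0, 0, 0, 1, 0, 0)"
definition del_uxy :: jet2 where "del_uxy = (0, 0, 0, 0, 0, 0, 1, 0)"
definition del_uyy :: jet2 where "del_uyy = (0, 0, 0, 0, 0, 0, 0, 1)"

lemmas del_defs = del_x_def del_y_def del_u_def del_ux_def del_uy_def
  del_uxx_def del_uxy_def del_uyy_def

fun D2_x :: "jet2 \<Rightarrow> jet2" where
  "D2_x (x, y, u, ux, uy, uxx, uxy, uyy) =
     del_x + ux *\<^sub>R del_u + uxx *\<^sub>R del_ux + uxy *\<^sub>R del_uy"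

fun D2_y :: "jet2 \<Rightarrow> jet2" where
  "D2_y (x, y, u, ux, uy, uxx, uxy, uyy) =
     del_y + uy *\<^sub>R del_u + uxy *\<^sub>R del_ux + uyy *\<^sub>R del_uy"

section \<open>The equation and the distribution\<close>

text \<open>The third-order PDE associated with a field of subspaces of the tangent spaces of \<open>J^2\<close>.\<close>

definition E_dist :: "(jet2 \<Rightarrow> jet2 set) \<Rightarrow> jet3 set" where
  "E_dist \<V> = {a \<in> J3_minus. T3 a \<inter> \<V> (proj32 a) \<noteq> {0}}"

fun b_coeff :: "jet2 \<Rightarrow> real" where
  "b_coeff (x, y, u, ux, uy, uxx, uxy, uyy) =
     uxy - sqrt (- det_Hess (x, y, u, ux, uy, uxx, uxy, uyy))"

text \<open>A 3-dimensional distribution on the part of \<open>J2_minus\<close> where \<open>u_yy\<close> does not vanish (see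
  \<open>dim_V_dist\<close>); where \<open>u_yy = 0\<close> the span has smaller dimension and carries no meaning.\<close>

definition V_dist :: "jet2 \<Rightarrow> jet2 set" where
  "V_dist a = span {- u_yy a *\<^sub>R D2_x a + b_coeff a *\<^sub>R D2_y a,
                    (2 * b_coeff a) *\<^sub>R del_uxx + u_yy a *\<^sub>R del_uxy,
                    - (b_coeff a)\<^sup>2 *\<^sub>R del_uxx + (u_yy a)\<^sup>2 *\<^sub>R del_uyy}"

fun E1_lhs :: "jet3 \<Rightarrow> real" where
  "E1_lhs ((x, y, u, ux, uy, uxx, uxy, uyy), uxxx, uxxy, uxyy, uyyy) =
     sqrt (- det_Hess (x, y, u, ux, uy, uxx, uxy, uyy)) *
       (uxx * uyy * uyyy - 3 * uxxy * uyy\<^sup>2 - 4 * uxy\<^sup>2 * uyyy + 6 * uxy * uxyy * uyy)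
     + (- 3 * uxx * uxy * uyy * uyyy + 3 * uxx * uxyy * uyy\<^sup>2 - uxxx * uyy ^ 3
        + 3 * uxxy * uxy * uyy\<^sup>2 + 4 * uxy ^ 3 * uyyy - 6 * uxy\<^sup>2 * uxyy * uyy)"

definition E1_minus :: "jet3 set" where
  "E1_minus = {a \<in> J3_minus. u_yy (proj32 a) \<noteq> 0 \<and> E1_lhs a = 0}"

section \<open>Well-definedness\<close>

subsection \<open>Dimension of the distribution\<close>

lemma dim_V_dist:
  assumes "u_yy a \<noteq> 0"
  shows "dim (V_dist a) = 3"
proof -
  obtain x y u ux uy uxx uxy uyy where a: "a = (x, y, u, ux, uy, uxx, uxy, uyy)"
    by (cases a) auto
  have n: "uyy \<noteq> 0" using assms a by simp
  define b where "b = b_coeff a"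
  let ?v1 = "- u_yy a *\<^sub>R D2_x a + b *\<^sub>R D2_y a"
  let ?v2 = "(2 * b) *\<^sub>R del_uxx + u_yy a *\<^sub>R del_uxy"
  let ?v3 = "- b\<^sup>2 *\<^sub>R del_uxx + (u_yy a)\<^sup>2 *\<^sub>R del_uyy"
  have i3: "?v3 \<notin> span {}" using n by (simp add: a del_defs zero_prod_def)
  have i2: "?v2 \<notin> span {?v3}" using n by (auto simp: a del_defs span_singleton)
  have i1: "?v1 \<notin> span {?v2, ?v3}"
    using n by (auto simp: a del_defs span_insert span_singleton)
  have "independent {?v1, ?v2, ?v3}"
    using i1 i2 i3 by (simp only: independent_insert) (auto simp: independent_insert independent_empty)
  then have "dim (V_dist a) = card {?v1, ?v2, ?v3}"
    unfolding V_dist_def b_def[symmetric] by (rule dim_span_eq_card_independent)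
  moreover have "card {?v1, ?v2, ?v3} = 3"
  proof -
    have "?v1 \<noteq> ?v2" "?v1 \<noteq> ?v3" "?v2 \<noteq> ?v3"
      using i1 i2 by (metis insertCI span_base)+
    then show ?thesis by simp
  qed
  ultimately show ?thesis by simp
qed

subsection \<open>Symmetry of mixed partial derivatives\<close>

lemma frechet_pd:
  assumes "f differentiable (at p)"
  shows "(f has_derivative (\<lambda>v. fst v * pd_x f p + snd v * pd_y f p)) (at p)"
proof -
  have d: "(f has_derivative frechet_derivative f (at p)) (at p)"
    using assms frechet_derivative_works by blast
  interpret linear "frechet_derivative f (at p)"
    using d has_derivative_linear by blast
  have "frechet_derivative f (at p) v = fst v * pd_x f p + snd v * pd_y f p" for v
  proof -
    have "v = fst v *\<^sub>R (1, 0) + snd v *\<^sub>R (0, 1)" by (cases v) simp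
    then have "frechet_derivative f (at p) v
        = frechet_derivative f (at p) (fst v *\<^sub>R (1, 0) + snd v *\<^sub>R (0, 1))"
      by simp
    then show ?thesis unfolding pd_x_def pd_y_def by (simp only: add scale real_scaleR_def)
  qed
  then have "frechet_derivative f (at p) = (\<lambda>v. fst v * pd_x f p + snd v * pd_y f p)"
    by (rule ext)
  then show ?thesis using d by simp
qed

lemma pdI:
  assumes "(f has_derivative (\<lambda>v. fst v * A + snd v * B)) (at p)"
  shows "pd_x f p = A" "pd_y f p = B"
  by (simp_all add: pd_x_def pd_y_def frechet_derivative_at[OF assms, symmetric])

lemma pd_x_line:
  assumes "\<And>p. f differentiable (at p)"
  shows "((\<lambda>s. f (s, t)) has_real_derivative pd_x f (s, t)) (at s)"
proof -
  have "((\<lambda>s. (s, t)) has_derivative (\<lambda>h. (h, 0))) (at s)"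
    by (auto intro!: derivative_eq_intros)
  from has_derivative_compose[OF this frechet_pd[OF assms]]
  show ?thesis by (simp add: has_field_derivative_def mult.commute[of _ "pd_x f (s, t)"])
qed

lemma pd_y_line:
  assumes "\<And>p. f differentiable (at p)"
  shows "((\<lambda>t. f (s, t)) has_real_derivative pd_y f (s, t)) (at t)"
proof -
  have "((\<lambda>t. (s, t)) has_derivative (\<lambda>h. (0, h))) (at t)"
    by (auto intro!: derivative_eq_intros)
  from has_derivative_compose[OF this frechet_pd[OF assms]]
  show ?thesis by (simp add: has_field_derivative_def mult.commute[of _ "pd_y f (s, t)"])
qed

lemma second_difference_x:
  assumes df: "\<And>p. f differentiable (at p)" and dx: "\<And>p. pd_x f differentiable (at p)"
    and h: "h > 0"
  obtains s t where "a < s" "s < a + h" "b < t" "t < b + h"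
    "f (a + h, b + h) - f (a + h, b) - f (a, b + h) + f (a, b) = h * h * pd_y (pd_x f) (s, t)"
proof -
  have "((\<lambda>s. f (s, b + h) - f (s, b)) has_real_derivative
      pd_x f (s, b + h) - pd_x f (s, b)) (at s)" for s
    by (intro DERIV_diff pd_x_line df)
  then obtain s where s: "a < s" "s < a + h" and e1:
    "(f (a + h, b + h) - f (a + h, b)) - (f (a, b + h) - f (a, b))
       = (a + h - a) * (pd_x f (s, b + h) - pd_x f (s, b))"
    using MVT2[of a "a + h" "\<lambda>s. f (s, b + h) - f (s, b)"
        "\<lambda>s. pd_x f (s, b + h) - pd_x f (s, b)"] h by auto
  obtain t where t: "b < t" "t < b + h" and e2:
    "pd_x f (s, b + h) - pd_x f (s, b) = (b + h - b) * pd_y (pd_x f) (s, t)"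
    using MVT2[of b "b + h" "\<lambda>t. pd_x f (s, t)" "\<lambda>t. pd_y (pd_x f) (s, t)"]
      h pd_y_line[OF dx] by auto
  show thesis using that[OF s t] e1 e2 by (simp add: algebra_simps)
qed

lemma second_difference_y:
  assumes df: "\<And>p. f differentiable (at p)" and dy: "\<And>p. pd_y f differentiable (at p)"
    and h: "h > 0"
  obtains s t where "a < s" "s < a + h" "b < t" "t < b + h"
    "f (a + h, b + h) - f (a + h, b) - f (a, b + h) + f (a, b) = h * h * pd_x (pd_y f) (s, t)"
proof -
  have "((\<lambda>t. f (a + h, t) - f (a, t)) has_real_derivative
      pd_y f (a + h, t) - pd_y f (a, t)) (at t)" for t
    by (intro DERIV_diff pd_y_line df)
  then obtain t where t: "b < t" "t < b + h" and e1:
    "(f (a + h, b + h) - f (a, b + h)) - (f (a + h, b) - f (a, b))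
       = (b + h - b) * (pd_y f (a + h, t) - pd_y f (a, t))"
    using MVT2[of b "b + h" "\<lambda>t. f (a + h, t) - f (a, t)"
        "\<lambda>t. pd_y f (a + h, t) - pd_y f (a, t)"] h by auto
  obtain s where s: "a < s" "s < a + h" and e2:
    "pd_y f (a + h, t) - pd_y f (a, t) = (a + h - a) * pd_x (pd_y f) (s, t)"
    using MVT2[of a "a + h" "\<lambda>s. pd_y f (s, t)" "\<lambda>s. pd_x (pd_y f) (s, t)"]
      h pd_x_line[OF dy] by auto
  show thesis using that[OF s t] e1 e2 by (simp add: algebra_simps)
qed

lemma C_k_continuous:
  assumes "C_k k f"
  shows "continuous_on UNIV f"
proof (cases k)
  case (Suc m)
  then have "f differentiable_on UNIV" using assms by (simp add: differentiable_on_def)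
  then show ?thesis by (rule differentiable_imp_continuous_on)
qed (use assms in auto)

lemma mixed_pd:
  assumes "C_k 2 f"
  shows "pd_x (pd_y f) p = pd_y (pd_x f) p"
proof -
  have f: "\<And>p. f differentiable (at p)" "\<And>p. pd_x f differentiable (at p)"
    "\<And>p. pd_y f differentiable (at p)"
    and c: "isCont (pd_x (pd_y f)) p" "isCont (pd_y (pd_x f)) p"
    using assms by (cases p; auto simp: numeral_2_eq_2 continuous_on_eq_continuous_at)+
  obtain a b where p: "p = (a, b)" by force
  define h where "h n = inverse (real (Suc n))" for n
  have hp: "h n > 0" for n by (simp add: h_def)
  have hl: "h \<longlonglongrightarrow> 0" unfolding h_def by (rule LIMSEQ_inverse_real_of_nat)
  have "\<exists>s t s' t'. a < s \<and> s < a + h n \<and> b < t \<and> t < b + h n \<and>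
      a < s' \<and> s' < a + h n \<and> b < t' \<and> t' < b + h n \<and>
      pd_y (pd_x f) (s, t) = pd_x (pd_y f) (s', t')" for n
  proof -
    obtain s t where 1: "a < s" "s < a + h n" "b < t" "t < b + h n"
      "f (a + h n, b + h n) - f (a + h n, b) - f (a, b + h n) + f (a, b)
        = h n * h n * pd_y (pd_x f) (s, t)"
      using second_difference_x[OF f(1,2) hp] by metis
    obtain s' t' where 2: "a < s'" "s' < a + h n" "b < t'" "t' < b + h n"
      "f (a + h n, b + h n) - f (a + h n, b) - f (a, b + h n) + f (a, b)
        = h n * h n * pd_x (pd_y f) (s', t')"
      using second_difference_y[OF f(1,3) hp] by metis
    have "h n * h n * pd_y (pd_x f) (s, t) = h n * h n * pd_x (pd_y f) (s', t')"
      using 1(5) 2(5) by (rule trans[OF sym])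
    then have "pd_y (pd_x f) (s, t) = pd_x (pd_y f) (s', t')"
      using hp[of n] by (metis mult_cancel_left mult_eq_0_iff less_irrefl)
    then show ?thesis using 1 2 by blast
  qed
  then obtain s t s' t' where st: "\<And>n. a < s n \<and> s n < a + h n \<and> b < t n \<and> t n < b + h n \<and>
      a < s' n \<and> s' n < a + h n \<and> b < t' n \<and> t' n < b + h n \<and>
      pd_y (pd_x f) (s n, t n) = pd_x (pd_y f) (s' n, t' n)"
    by metis
  have sq: "r \<longlonglongrightarrow> c" if "\<And>n. c < r n \<and> r n < c + h n" for r c
  proof (rule tendsto_sandwich[where f="\<lambda>_. c" and h="\<lambda>n. c + h n"])
    show "(\<lambda>n. c + h n) \<longlonglongrightarrow> c" using tendsto_add[OF tendsto_const hl, of c] by simp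
  qed (use that in \<open>auto simp: less_imp_le intro!: always_eventually\<close>)
  have l: "(\<lambda>n. (s n, t n)) \<longlonglongrightarrow> p" "(\<lambda>n. (s' n, t' n)) \<longlonglongrightarrow> p"
    unfolding p by (intro tendsto_Pair sq; use st in blast)+
  have "(\<lambda>n. pd_y (pd_x f) (s n, t n)) \<longlonglongrightarrow> pd_y (pd_x f) p"
    using isCont_tendsto_compose[OF c(2) l(1)] .
  moreover have "(\<lambda>n. pd_y (pd_x f) (s n, t n)) \<longlonglongrightarrow> pd_x (pd_y f) p"
    using isCont_tendsto_compose[OF c(1) l(2)] st by simp
  ultimately show ?thesis using LIMSEQ_unique by blast
qed

subsection \<open>The tangent plane determined by a 3-jet\<close>

fun T3_x :: "jet3 \<Rightarrow> jet2" where
  "T3_x (a, uxxx, uxxy, uxyy, uyyy) =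
     D2_x a + uxxx *\<^sub>R del_uxx + uxxy *\<^sub>R del_uxy + uxyy *\<^sub>R del_uyy"

fun T3_y :: "jet3 \<Rightarrow> jet2" where
  "T3_y (a, uxxx, uxxy, uxyy, uyyy) =
     D2_y a + uxxy *\<^sub>R del_uxx + uxyy *\<^sub>R del_uxy + uyyy *\<^sub>R del_uyy"

lemma smooth2_pd:
  assumes "smooth2 f"
  shows "smooth2 (pd_x f)" "smooth2 (pd_y f)" "f differentiable (at p)"
  using assms C_k.simps(2) unfolding smooth2_def by blast+

lemma smooth2_mixed_pd:
  assumes "smooth2 f"
  shows "pd_x (pd_y f) = pd_y (pd_x f)"
  using assms mixed_pd unfolding smooth2_def by blast

lemma j2_has_derivative:
  assumes f: "smooth2 f"
  shows "(j2 f has_derivative (\<lambda>v. fst v *\<^sub>R T3_x (j3 f p) + snd v *\<^sub>R T3_y (j3 f p))) (at p)"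
proof -
  note s = f smooth2_pd(1,2)[OF f]
  note s2 = smooth2_pd(1)[OF s(2)] smooth2_pd(2)[OF s(2)] smooth2_pd(2)[OF s(3)]
  note d = frechet_pd[OF smooth2_pd(3)]
  have "(j2 f has_derivative (\<lambda>v. (fst v, snd v,
      fst v * pd_x f p + snd v * pd_y f p,
      fst v * pd_x (pd_x f) p + snd v * pd_y (pd_x f) p,
      fst v * pd_x (pd_y f) p + snd v * pd_y (pd_y f) p,
      fst v * pd_x (pd_x (pd_x f)) p + snd v * pd_y (pd_x (pd_x f)) p,
      fst v * pd_x (pd_y (pd_x f)) p + snd v * pd_y (pd_y (pd_x f)) p,
      fst v * pd_x (pd_y (pd_y f)) p + snd v * pd_y (pd_y (pd_y f)) p))) (at p)"
    unfolding j2_def[abs_def]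
    by (intro has_derivative_Pair d s s2 has_derivative_fst has_derivative_snd has_derivative_ident)
  moreover have "pd_x (pd_y (pd_x f)) p = pd_y (pd_x (pd_x f)) p"
    "pd_x (pd_y (pd_y f)) p = pd_y (pd_y (pd_x f)) p" "pd_x (pd_y f) p = pd_y (pd_x f) p"
    using smooth2_mixed_pd s by metis+
  ultimately show ?thesis
    by (simp add: j3_def j2_def del_defs)
qed

lemma range_derivative_j2:
  assumes "smooth2 f"
  shows "range (frechet_derivative (j2 f) (at p)) = span {T3_x (j3 f p), T3_y (j3 f p)}"
proof -
  have "frechet_derivative (j2 f) (at p)
      = (\<lambda>v. fst v *\<^sub>R T3_x (j3 f p) + snd v *\<^sub>R T3_y (j3 f p))"
    using frechet_derivative_at[OF j2_has_derivative[OF assms]] by simp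
  moreover have "range (\<lambda>v. fst v *\<^sub>R A + snd v *\<^sub>R B) = span {A, B}" for A B :: jet2
  proof -
    have "w \<in> span {A, B} \<longleftrightarrow> (\<exists>s t. w = s *\<^sub>R A + t *\<^sub>R B)" for w
      by (simp add: span_insert[of A "{B}"] span_singleton image_iff diff_eq_eq add.commute)
    then show ?thesis unfolding set_eq_iff image_iff by (metis UNIV_I fst_conv snd_conv)
  qed
  ultimately show ?thesis by simp
qed

definition cubic :: "(nat \<Rightarrow> real) \<Rightarrow> real \<times> real \<Rightarrow> real" where
  "cubic c p = c 0 + c 1 * fst p + c 2 * snd p
     + c 3 * fst p * fst p + c 4 * fst p * snd p + c 5 * snd p * snd p
     + c 6 * fst p * fst p * fst p + c 7 * fst p * fst p * snd p
     + c 8 * fst p * snd p * snd p + c 9 * snd p * snd p * snd p"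

definition cubic_x :: "(nat \<Rightarrow> real) \<Rightarrow> nat \<Rightarrow> real" where
  "cubic_x c = (\<lambda>_. 0)(0 := c 1, 1 := 2 * c 3, 2 := c 4, 3 := 3 * c 6, 4 := 2 * c 7, 5 := c 8)"

definition cubic_y :: "(nat \<Rightarrow> real) \<Rightarrow> nat \<Rightarrow> real" where
  "cubic_y c = (\<lambda>_. 0)(0 := c 2, 1 := c 4, 2 := 2 * c 5, 3 := c 7, 4 := 2 * c 8, 5 := 3 * c 9)"

lemma cubic_has_derivative:
  "(cubic c has_derivative
     (\<lambda>v. fst v * cubic (cubic_x c) p + snd v * cubic (cubic_y c) p)) (at p)"
  unfolding cubic_def[abs_def]
  by (rule derivative_eq_intros refl)+
    (simp add: fun_eq_iff cubic_x_def cubic_y_def algebra_simps)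

lemma pd_cubic:
  "pd_x (cubic c) = cubic (cubic_x c)" "pd_y (cubic c) = cubic (cubic_y c)"
  using pdI[OF cubic_has_derivative] by blast+

lemma smooth2_cubic: "smooth2 (cubic c)"
proof -
  have d: "cubic c differentiable (at p)" for c p
    using cubic_has_derivative differentiable_def by blast
  have "C_k k (cubic c)" for k
  proof (induction k arbitrary: c)
    case 0
    have "cubic c differentiable_on UNIV" using d by (simp add: differentiable_on_def)
    then show ?case by (simp add: differentiable_imp_continuous_on)
  next
    case (Suc k)
    then show ?case by (simp add: d pd_cubic)
  qed
  then show ?thesis by (simp add: smooth2_def)
qed

lemma ex_smooth2_j3: "\<exists>f p. smooth2 f \<and> j3 f p = a"
proof -
  obtain x y u ux uy uxx uxy uyy uxxx uxxy uxyy uyyy where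
    a: "a = ((x, y, u, ux, uy, uxx, uxy, uyy), uxxx, uxxy, uxyy, uyyy)"
    by (cases a) auto
  define c9 where "c9 = uyyy / 6"
  define c8 where "c8 = uxyy / 2"
  define c7 where "c7 = uxxy / 2"
  define c6 where "c6 = uxxx / 6"
  define c5 where "c5 = (uyy - 2 * c8 * x - 6 * c9 * y) / 2"
  define c4 where "c4 = uxy - 2 * c7 * x - 2 * c8 * y"
  define c3 where "c3 = (uxx - 6 * c6 * x - 2 * c7 * y) / 2"
  define c2 where "c2 = uy - (c4 * x + 2 * c5 * y + c7 * x * x + 2 * c8 * x * y + 3 * c9 * y * y)"
  define c1 where "c1 = ux - (2 * c3 * x + c4 * y + 3 * c6 * x * x + 2 * c7 * x * y + c8 * y * y)"
  define c0 where "c0 = u - (c1 * x + c2 * y + c3 * x * x + c4 * x * y + c5 * y * y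
    + c6 * x * x * x + c7 * x * x * y + c8 * x * y * y + c9 * y * y * y)"
  define c :: "nat \<Rightarrow> real" where "c = (\<lambda>_. 0)(0 := c0, 1 := c1, 2 := c2, 3 := c3, 4 := c4, 5 := c5,
    6 := c6, 7 := c7, 8 := c8, 9 := c9)"
  have 0: "cubic c (x, y) = u"
    by (simp add: cubic_def c_def c0_def)
  have 1: "cubic (cubic_x c) (x, y) = ux"
    by (simp add: cubic_def cubic_x_def c_def c1_def)
  have 2: "cubic (cubic_y c) (x, y) = uy"
    by (simp add: cubic_def cubic_y_def c_def c2_def)
  have 3: "cubic (cubic_x (cubic_x c)) (x, y) = uxx"
    "cubic (cubic_y (cubic_x c)) (x, y) = uxy"
    "cubic (cubic_y (cubic_y c)) (x, y) = uyy"
    by (simp_all add: cubic_def cubic_x_def cubic_y_def c_def c3_def c4_def c5_def field_simps)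
  have 4: "cubic (cubic_x (cubic_x (cubic_x c))) (x, y) = uxxx"
    "cubic (cubic_y (cubic_x (cubic_x c))) (x, y) = uxxy"
    "cubic (cubic_y (cubic_y (cubic_x c))) (x, y) = uxyy"
    "cubic (cubic_y (cubic_y (cubic_y c))) (x, y) = uyyy"
    by (simp_all add: cubic_def cubic_x_def cubic_y_def c_def c6_def c7_def c8_def c9_def)
  have "j3 (cubic c) (x, y) = a"
    by (simp add: j3_def j2_def pd_cubic 0 1 2 3 4 a)
  then show ?thesis using smooth2_cubic by blast
qed

lemma T3_eq_span: "T3 a = span {T3_x a, T3_y a}"
proof -
  have *: "range (frechet_derivative (j2 f) (at p)) = span {T3_x a, T3_y a}"
    if "smooth2 f" "j3 f p = a" for f p
    using range_derivative_j2[OF that(1), of p] that(2) by simp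
  have "\<exists>f p. smooth2 f \<and> j3 f p = a" by (rule ex_smooth2_j3)
  then have "{range (frechet_derivative (j2 f) (at p)) | f p. smooth2 f \<and> j3 f p = a}
      = {span {T3_x a, T3_y a}}"
    using * by blast
  then show ?thesis by (simp add: T3_def)
qed

end

theory Submission
  imports Defs
begin

text \<open>
  Comparing the \<open>\<partial>\<^sub>x\<close> and \<open>\<partial>\<^sub>y\<close> components, a nonzero vector in the intersection must be a multiple
  of the combination of the two generators of the tangent plane with coefficients
  \<open>(- u_yy, b)\<close>. Its second-order components lie in the span of the two vertical generators exactly if
  \<open>b\<^sup>3 u_yyy - 3 u_yy b\<^sup>2 u_xyy + 3 u_yy\<^sup>2 b u_xxy - u_yy\<^sup>3 u_xxx = 0\<close>. Since \<open>u_xy - b\<close> is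
  the square root of \<open>- det Hess\<close>, this is the given equation.
\<close>

text \<open>The right-hand side is the binary cubic form with coefficients \<open>uxxx\<close>,
  \<open>3 * uxxy\<close>, \<open>3 * uxyy\<close>, \<open>uyyy\<close>, evaluated at the direction
  \<open>(- uyy, b)\<close>.\<close>

lemma E1_lhs_eq_cubic_form:
  fixes x y u ux uy uxx uxy uyy uxxx uxxy uxyy uyyy :: real
  defines "a \<equiv> (x, y, u, ux, uy, uxx, uxy, uyy)"
  defines "b \<equiv> b_coeff a"
  assumes "det_Hess a < 0"
  shows "E1_lhs (a, uxxx, uxxy, uxyy, uyyy) =
    b ^ 3 * uyyy - 3 * uyy * b\<^sup>2 * uxyy + 3 * uyy\<^sup>2 * b * uxxy - uyy ^ 3 * uxxx"
proof -
  define r where "r = sqrt (- det_Hess a)"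
  have r2: "r\<^sup>2 = uxy\<^sup>2 - uxx * uyy"
    using assms(3) by (simp add: r_def a_def)
  have b: "b = uxy - r"
    by (simp add: b_def r_def a_def)
  have "E1_lhs (a, uxxx, uxxy, uxyy, uyyy) =
    r * (uxx * uyy * uyyy - 3 * uxxy * uyy\<^sup>2 - 4 * uxy\<^sup>2 * uyyy + 6 * uxy * uxyy * uyy)
     + (- 3 * uxx * uxy * uyy * uyyy + 3 * uxx * uxyy * uyy\<^sup>2 - uxxx * uyy ^ 3
        + 3 * uxxy * uxy * uyy\<^sup>2 + 4 * uxy ^ 3 * uyyy - 6 * uxy\<^sup>2 * uxyy * uyy)"
    by (simp add: r_def a_def)
  \<comment> \<open>Expanding in \<open>r\<close> and reducing modulo \<open>r2\<close> makes both
    sides agree; the hypothesis \<open>det_Hess a < 0\<close> enters only through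
    \<open>r2\<close>.\<close>
  also have "\<dots> = b ^ 3 * uyyy - 3 * uyy * b\<^sup>2 * uxyy + 3 * uyy\<^sup>2 * b * uxxy - uyy ^ 3 * uxxx"
    using r2 unfolding b by algebra
  finally show ?thesis .
qed

lemma mem_V_dist_iff:
  "w \<in> V_dist a \<longleftrightarrow> (\<exists>k l m.
     w = k *\<^sub>R (- u_yy a *\<^sub>R D2_x a + b_coeff a *\<^sub>R D2_y a)
       + l *\<^sub>R ((2 * b_coeff a) *\<^sub>R del_uxx + u_yy a *\<^sub>R del_uxy)
       + m *\<^sub>R (- (b_coeff a)\<^sup>2 *\<^sub>R del_uxx + (u_yy a)\<^sup>2 *\<^sub>R del_uyy))"
  unfolding V_dist_def span_insert span_singleton mem_Collect_eq image_iff bex_UNIV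
  by (simp add: algebra_simps)

lemma mem_T3_iff: "w \<in> T3 a \<longleftrightarrow> (\<exists>s t. w = s *\<^sub>R T3_x a + t *\<^sub>R T3_y a)"
  unfolding T3_eq_span span_insert span_singleton mem_Collect_eq image_iff bex_UNIV
  by (simp add: algebra_simps)

lemma T3_Int_V_dist_nonzero_iff:
  fixes x y u ux uy uxx uxy uyy uxxx uxxy uxyy uyyy :: real
  defines "a \<equiv> (x, y, u, ux, uy, uxx, uxy, uyy)"
  defines "b \<equiv> b_coeff a"
  assumes n: "uyy \<noteq> 0"
  shows "T3 (a, uxxx, uxxy, uxyy, uyyy) \<inter> V_dist a \<noteq> {0} \<longleftrightarrow>
    b ^ 3 * uyyy - 3 * uyy * b\<^sup>2 * uxyy + 3 * uyy\<^sup>2 * b * uxxy - uyy ^ 3 * uxxx = 0"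
    (is "?T \<inter> _ \<noteq> _ \<longleftrightarrow> ?F = 0")
proof -
  \<comment> \<open>\<open>A\<close>, \<open>B\<close>, \<open>C\<close> are the second-order
    components of \<open>- uyy\<close> times \<open>T3_x\<close> plus \<open>b\<close> times
    \<open>T3_y\<close>.\<close>
  define A where "A = - uyy * uxxx + b * uxxy"
  define B where "B = - uyy * uxxy + b * uxyy"
  define C where "C = - uyy * uxyy + b * uyyy"
  \<comment> \<open>The functional with coefficients \<open>uyy\<^sup>2\<close>,
    \<open>- 2 * b * uyy\<close>, \<open>b\<^sup>2\<close> annihilates both vertical generators of
    \<open>V_dist a\<close>.\<close>
  have F: "?F = uyy\<^sup>2 * A - 2 * b * uyy * B + b\<^sup>2 * C"
    unfolding A_def B_def C_def by algebra
  have "0 \<in> ?T \<inter> V_dist a"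
    by (simp add: T3_eq_span V_dist_def span_zero)
  then have "?T \<inter> V_dist a \<noteq> {0} \<longleftrightarrow> (\<exists>w \<in> ?T \<inter> V_dist a. w \<noteq> 0)"
    by blast
  also have "\<dots> \<longleftrightarrow> ?F = 0"
  proof
    assume "\<exists>w \<in> ?T \<inter> V_dist a. w \<noteq> 0"
    then obtain w s t k l m where w0: "w \<noteq> 0"
      and wT: "w = s *\<^sub>R T3_x (a, uxxx, uxxy, uxyy, uyyy) + t *\<^sub>R T3_y (a, uxxx, uxxy, uxyy, uyyy)"
      and wV: "w = k *\<^sub>R (- u_yy a *\<^sub>R D2_x a + b *\<^sub>R D2_y a)
        + l *\<^sub>R ((2 * b) *\<^sub>R del_uxx + u_yy a *\<^sub>R del_uxy)
        + m *\<^sub>R (- b\<^sup>2 *\<^sub>R del_uxx + (u_yy a)\<^sup>2 *\<^sub>R del_uyy)"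
      unfolding Bex_def Int_iff mem_T3_iff mem_V_dist_iff b_def by blast
    have s: "s = - uyy * k" and t: "t = b * k"
      and h: "s * uxxx + t * uxxy = 2 * b * l - b\<^sup>2 * m"
        "s * uxxy + t * uxyy = uyy * l" "s * uxyy + t * uyyy = uyy\<^sup>2 * m"
      using wT wV by (simp_all add: a_def del_defs algebra_simps)
    \<comment> \<open>For \<open>k = 0\<close> both \<open>s\<close> and \<open>t\<close> vanish:
      the tangent plane contains no nonzero vertical vector.\<close>
    have "k \<noteq> 0"
      using w0 wT s t by auto
    \<comment> \<open>Applying the functional from \<open>F\<close> to the equations
      \<open>h\<close> eliminates \<open>l\<close> and \<open>m\<close>.\<close>
    moreover have "k * ?F = 0"
      using h unfolding s t by algebra
    ultimately show "?F = 0" by simp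
  next
    assume "?F = 0"
    \<comment> \<open>With \<open>k = 1\<close>, the \<open>del_uxy\<close> and
      \<open>del_uyy\<close> components force \<open>l\<close> and \<open>m\<close>; the
      \<open>del_uxx\<close> component is then what \<open>?F = 0\<close> provides.\<close>
    define l where "l = B / uyy"
    define m where "m = C / uyy\<^sup>2"
    have B: "B = uyy * l" and C: "C = uyy\<^sup>2 * m"
      using n by (simp_all add: l_def m_def)
    have "uyy\<^sup>2 * A = uyy\<^sup>2 * (2 * b * l - b\<^sup>2 * m)"
      using \<open>?F = 0\<close> unfolding F B C by algebra
    then have A: "A = 2 * b * l - b\<^sup>2 * m"
      using n by simp
    define w where "w = (- uyy) *\<^sub>R T3_x (a, uxxx, uxxy, uxyy, uyyy)
      + b *\<^sub>R T3_y (a, uxxx, uxxy, uxyy, uyyy)"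
    have "w = 1 *\<^sub>R (- u_yy a *\<^sub>R D2_x a + b *\<^sub>R D2_y a)
        + l *\<^sub>R ((2 * b) *\<^sub>R del_uxx + u_yy a *\<^sub>R del_uxy)
        + m *\<^sub>R (- b\<^sup>2 *\<^sub>R del_uxx + (u_yy a)\<^sup>2 *\<^sub>R del_uyy)"
      using A B C by (simp add: w_def a_def del_defs A_def B_def C_def algebra_simps)
    then have "w \<in> V_dist a"
      unfolding mem_V_dist_iff b_def by blast
    moreover have "w \<in> ?T"
      unfolding mem_T3_iff w_def by blast
    \<comment> \<open>The \<open>del_x\<close> component of \<open>w\<close> is
      \<open>- uyy\<close>.\<close>
    moreover have "w \<noteq> 0"
      using n by (simp add: w_def a_def del_defs zero_prod_def)
    ultimately show "\<exists>w \<in> ?T \<inter> V_dist a. w \<noteq> 0" by blast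
  qed
  finally show ?thesis .
qed

theorem mainTheorem8:
  shows "E1_minus = E_dist V_dist \<inter> {a. u_yy (proj32 a) \<noteq> 0}"
proof (rule set_eqI)
  fix a :: jet3
  obtain x y u ux uy uxx uxy uyy uxxx uxxy uxyy uyyy where
    a: "a = ((x, y, u, ux, uy, uxx, uxy, uyy), uxxx, uxxy, uxyy, uyyy)"
    by (cases a) auto
  have "E1_lhs a = 0 \<longleftrightarrow> T3 a \<inter> V_dist (proj32 a) \<noteq> {0}"
    if "a \<in> J3_minus" "u_yy (proj32 a) \<noteq> 0"
  proof -
    have d: "det_Hess (x, y, u, ux, uy, uxx, uxy, uyy) < 0" and n: "uyy \<noteq> 0"
      using that by (simp_all add: a proj32_def J3_minus_def J2_minus_def)
    show ?thesis
      unfolding a proj32_def fst_conv E1_lhs_eq_cubic_form[OF d] T3_Int_V_dist_nonzero_iff[OF n] ..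
  qed
  then show "a \<in> E1_minus \<longleftrightarrow> a \<in> E_dist V_dist \<inter> {a. u_yy (proj32 a) \<noteq> 0}"
    by (auto simp: E1_minus_def E_dist_def)
qed

end
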